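(* Let $\lambda_B$ be the random variable given by the spectral radius of the random Ruelle operator $\mathscr{L}_{B_{t(\cdot)}}$ associated to the Brownian potential. Then $\lambda_B$ has finite first moment with respect to the Wiener measure, and moreover $$\exp(1/2)\le \mathbb{E}[\lambda_B]\le 4\exp(1/2).$$
   Context: Let $\Omega=\{0,1\}^{\mathbb{N}}$ with $\mathbb{N}=\{1,2,\ldots\}$, a compact metric space with the metric $d(x,y)=2^{-N}$, $N=\inf\{i\in\mathbb{N}: x_i\neq y_i\}$. $C(\Omega)$ is the space of real continuous functions on $\Omega$ with the supremum norm. For $f\in C(\Omega)$ the Ruelle operator $\mathscr{L}_f:C(\Omega)\to C(\Omega)$ is $\mathscr{L}_f(\varphi)(x)=\sum_{a=0,1}\exp(f(ax))\varphi(ax)$, where $ax=(a,x_1,x_2,\ldots)$. Define $t:\Omega\to[0,1]$ by $t(x)=\sum_{n\ge1}2^{-n}x_n$. Let $\{B_s:s\in[0,1]\}$ be a standard one-dimensional Brownian motion (with $B_0=0$ and almost surely continuous paths) on a complete probability space. The Brownian potential is the random function $x\mapsto B_{t(x)}$ on $\Omega$, which is almost surely continuous, so that almost surely $\mathscr{L}_{B_{t(\cdot)}}:C(\Omega)\to C(\Omega)$ is a well-defined bounded operator; $\lambda_B$ denotes its spectral radius. $\mathbb{E}$ denotes expectation with respect to the Wiener measure (the law of $B$). *)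

theory Defs
  imports "HOL-Probability.Probability" "HOL-Library.Stream"
begin

section \<open>The symbolic space\<close>

text \<open>
  The space of sequences over the alphabet \<open>{0,1}\<close> is rendered as the type \<open>bool stream\<close>
  (\<open>False\<close> is \<open>0\<close>, \<open>True\<close> is \<open>1\<close>).  Streams are indexed from \<open>0\<close>, so the coordinate \<open>x\<^sub>i\<close> with
  \<open>i \<ge> 1\<close> is \<open>x !! (i - 1)\<close>; this accounts for the \<open>Suc\<close> in the exponents below.
  The sequence \<open>a x\<close> is \<open>a ## x\<close>.
\<close>

instantiation stream :: (type) metric_space
begin

definition dist_stream :: "'a stream \<Rightarrow> 'a stream \<Rightarrow> real" where
  "dist_stream x y = (if x = y then 0 else (1/2) ^ Suc (LEAST i. x !! i \<noteq> y !! i))"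

definition uniformity_stream :: "('a stream \<times> 'a stream) filter" where
  "uniformity_stream = (INF e\<in>{0 <..}. principal {(x, y). dist x y < e})"

definition open_stream :: "'a stream set \<Rightarrow> bool" where
  "open_stream U = (\<forall>x\<in>U. \<forall>\<^sub>F (x', y) in uniformity. x' = x \<longrightarrow> y \<in> U)"

lemma stream_neq_iff: "x \<noteq> y \<longleftrightarrow> (\<exists>i. x !! i \<noteq> y !! i)" for x y :: "'a stream"
proof
  assume "x \<noteq> y"
  show "\<exists>i. x !! i \<noteq> y !! i"
  proof (rule ccontr)
    assume "\<not> ?thesis"
    then have "(!!) x = (!!) y" by (intro ext) simp
    with \<open>x \<noteq> y\<close> show False by (metis stream_smap_nats)
  qed
qed auto

lemma dist_stream_le_iff:
  "dist x y \<le> (1/2) ^ Suc n \<longleftrightarrow> (\<forall>i<n. x !! i = y !! i)" for x y :: "'a stream"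
proof (cases "x = y")
  case False
  then obtain k where k: "x !! k \<noteq> y !! k" using stream_neq_iff by blast
  let ?L = "LEAST i. x !! i \<noteq> y !! i"
  have L: "x !! ?L \<noteq> y !! ?L" using k by (rule LeastI)
  have less: "x !! i = y !! i" if "i < ?L" for i using not_less_Least[OF that] by blast
  have "dist x y \<le> (1/2) ^ Suc n \<longleftrightarrow> n \<le> ?L"
    using False by (simp add: dist_stream_def power_decreasing_iff del: power_Suc)
  also have "\<dots> \<longleftrightarrow> (\<forall>i<n. x !! i = y !! i)"
    using L less by (meson dual_order.strict_trans1 not_le)
  finally show ?thesis .
qed (simp add: dist_stream_def)

instance
proof
  fix x y z :: "'a stream"
  show "dist x y = 0 \<longleftrightarrow> x = y" by (simp add: dist_stream_def)
  have nonneg: "dist u v \<ge> 0" for u v :: "'a stream" by (simp add: dist_stream_def)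
  have sym: "dist u v = dist v u" for u v :: "'a stream"
  proof -
    have "(LEAST i. u !! i \<noteq> v !! i) = (LEAST i. v !! i \<noteq> u !! i)"
      by (rule arg_cong[where f = Least]) auto
    then show ?thesis unfolding dist_stream_def by (cases "u = v") auto
  qed
  have form: "u = v \<or> (\<exists>n. dist u v = (1/2) ^ Suc n)" for u v :: "'a stream"
    by (auto simp: dist_stream_def)
  show "dist x y \<le> dist x z + dist y z"
  proof -
    consider "x = z" | "y = z" | m n where "dist x z = (1/2) ^ Suc m" "dist y z = (1/2) ^ Suc n"
      using form[of x z] form[of y z] by blast
    then show ?thesis
    proof cases
      case 1 then show ?thesis using sym[of x y] nonneg[of x z] by simp
    next
      case 2 then show ?thesis using nonneg[of y z] by simp
    next
      case 3
      have "\<forall>i<m. x !! i = z !! i" "\<forall>i<n. y !! i = z !! i"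
        using 3 by (simp_all add: dist_stream_le_iff[symmetric] del: power_Suc)
      then have "dist x y \<le> (1/2) ^ Suc (min m n)" by (simp add: dist_stream_le_iff del: power_Suc)
      also have "\<dots> \<le> dist x z + dist y z"
        using 3 nonneg[of x z] nonneg[of y z] by (cases "m \<le> n") (auto simp: min_def simp del: power_Suc)
      finally show ?thesis .
    qed
  qed
qed (simp_all add: uniformity_stream_def open_stream_def)

end

lemma continuous_on_streamI:
  fixes f :: "'a::topological_space \<Rightarrow> 'b stream"
  assumes "\<And>x n. \<exists>U. open U \<and> x \<in> U \<and> (\<forall>y\<in>U. \<forall>i<n. f x !! i = f y !! i)"
  shows "continuous_on UNIV f"
  unfolding continuous_on_def
proof
  fix x
  show "(f \<longlongrightarrow> f x) (at x)"
    unfolding tendsto_iff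
  proof (intro allI impI)
    fix e :: real assume "e > 0"
    then obtain n where n: "(1/2::real) ^ n < e" using real_arch_pow_inv[of e "1/2"] by auto
    obtain U where U: "open U" "x \<in> U" "\<forall>y\<in>U. \<forall>i<n. f x !! i = f y !! i"
      using assms by blast
    have "dist (f y) (f x) < e" if "y \<in> U" for y
    proof -
      have "dist (f y) (f x) \<le> (1/2) ^ Suc n"
        using U(3) that by (auto simp: dist_stream_le_iff simp del: power_Suc)
      also have "\<dots> \<le> (1/2) ^ n" by simp
      finally show ?thesis using n by simp
    qed
    then show "\<forall>\<^sub>F y in at x. dist (f y) (f x) < e"
      using U(1,2) unfolding eventually_at_topological by blast
  qed
qed

lemma compact_UNIV_stream: "compact (UNIV :: 'a::finite stream set)"
proof -
  define P where "P = (product_topology (\<lambda>_. discrete_topology UNIV) UNIV :: (nat \<Rightarrow> 'a) topology)"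
  define F where "F = (\<lambda>g :: nat \<Rightarrow> 'a. to_stream g)"
  have Fnth: "F g !! n = g n" for g n by (simp add: F_def to_stream_def)
  have "compact_space P"
    unfolding P_def compact_space_product_topology by (simp add: compact_space_discrete_topology)
  then have "compactin P (topspace P)" by (simp add: compact_space_def)
  moreover have "continuous_map P euclidean F"
    unfolding continuous_map_atin
  proof (intro ballI)
    fix g assume "g \<in> topspace P"
    show "limitin euclidean F (F g) (atin P g)"
      unfolding limitin_canonical_iff tendsto_iff
    proof (intro allI impI)
      fix e :: real assume "e > 0"
      then obtain n where n: "(1/2::real) ^ n < e" using real_arch_pow_inv[of e "1/2"] by auto
      define U where "U = PiE UNIV (\<lambda>i. if i < n then {g i} else UNIV)"
      have "openin P U"
        unfolding P_def U_def
        by (rule product_topology_basis) (auto intro: finite_subset[of _ "{..<n}"])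
      moreover have "g \<in> U" by (auto simp: U_def)
      moreover have "dist (F h) (F g) < e" if "h \<in> U" for h
      proof -
        have "h i = g i" if "i < n" for i
          using \<open>h \<in> U\<close> that by (auto simp: U_def PiE_def Pi_def) (metis singletonD)
        then have "dist (F h) (F g) \<le> (1/2) ^ Suc n"
          by (auto simp: dist_stream_le_iff Fnth simp del: power_Suc)
        also have "\<dots> \<le> (1/2) ^ n" by simp
        finally show ?thesis using n by simp
      qed
      ultimately show "\<forall>\<^sub>F h in atin P g. dist (F h) (F g) < e"
        unfolding eventually_atin by blast
    qed
  qed
  ultimately have "compactin euclidean (F ` topspace P)" by (rule image_compactin)
  moreover have "F ` topspace P = UNIV"
  proof -
    have "x = F ((!!) x)" for x by (metis Fnth stream_neq_iff)
    then show ?thesis by (auto simp: P_def)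
  qed
  ultimately show ?thesis by simp
qed

lemma stream_bcontfun_iff:
  "f \<in> bcontfun \<longleftrightarrow> continuous_on UNIV f" for f :: "bool stream \<Rightarrow> real"
  by (auto simp: bcontfun_def intro!: compact_imp_bounded compact_continuous_image compact_UNIV_stream)

lemma continuous_on_SCons: "continuous_on UNIV (\<lambda>x. a ## x)"
proof (rule continuous_on_streamI)
  fix x :: "'a stream" and n
  have "y \<in> ball x ((1/2) ^ n) \<Longrightarrow> \<forall>i<n. (a ## x) !! i = (a ## y) !! i" for y
  proof (cases n)
    case (Suc m)
    assume "y \<in> ball x ((1/2) ^ n)"
    then have "dist x y \<le> (1/2) ^ Suc m" using Suc by (simp del: power_Suc)
    then have "\<forall>i<m. x !! i = y !! i" by (simp add: dist_stream_le_iff del: power_Suc)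
    then show ?thesis using Suc by (auto simp: less_Suc_eq_0_disj)
  qed simp
  then show "\<exists>U. open U \<and> x \<in> U \<and> (\<forall>y\<in>U. \<forall>i<n. (a ## x) !! i = (a ## y) !! i)"
    by (intro exI[of _ "ball x ((1/2) ^ n)"]) auto
qed


section \<open>The Ruelle operator\<close>

text \<open>
  Since the sequence space is compact, \<open>bool stream \<Rightarrow>\<^sub>C real\<close> is the space of all
  real continuous functions on it with the supremum norm.
\<close>

definition ruelle_apply ::
    "(bool stream \<Rightarrow>\<^sub>C real) \<Rightarrow> (bool stream \<Rightarrow>\<^sub>C real) \<Rightarrow> (bool stream \<Rightarrow>\<^sub>C real)" where
  "ruelle_apply f \<phi> = Bcontfun (\<lambda>x. \<Sum>a\<in>UNIV. exp (f (a ## x)) * \<phi> (a ## x))"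

definition ruelle ::
    "(bool stream \<Rightarrow>\<^sub>C real) \<Rightarrow> (bool stream \<Rightarrow>\<^sub>C real) \<Rightarrow>\<^sub>L (bool stream \<Rightarrow>\<^sub>C real)" where
  "ruelle f = Blinfun (ruelle_apply f)"

lemma ruelle_apply_apply:
  "apply_bcontfun (ruelle_apply f \<phi>) x = (\<Sum>a\<in>UNIV. exp (f (a ## x)) * \<phi> (a ## x))"
proof -
  have "continuous_on UNIV (\<lambda>x. f (a ## x))" "continuous_on UNIV (\<lambda>x. \<phi> (a ## x))" for a
    by (auto intro: continuous_on_compose2[OF continuous_on_apply_bcontfun continuous_on_SCons])
  then have "(\<lambda>x. \<Sum>a\<in>UNIV. exp (f (a ## x)) * \<phi> (a ## x)) \<in> bcontfun"
    unfolding stream_bcontfun_iff by (intro continuous_intros)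
  then show ?thesis by (simp add: ruelle_apply_def Bcontfun_inverse)
qed

lemma blinfun_apply_ruelle: "blinfun_apply (ruelle f) = ruelle_apply f"
proof -
  have "bounded_linear (ruelle_apply f)"
  proof (rule bounded_linear_intro[where K = "2 * exp (norm f)"])
    fix \<phi> \<psi> :: "bool stream \<Rightarrow>\<^sub>C real" and r :: real
    show "ruelle_apply f (\<phi> + \<psi>) = ruelle_apply f \<phi> + ruelle_apply f \<psi>"
      by (rule bcontfun_eqI) (simp add: ruelle_apply_apply algebra_simps sum.distrib)
    show "ruelle_apply f (r *\<^sub>R \<phi>) = r *\<^sub>R ruelle_apply f \<phi>"
      by (rule bcontfun_eqI) (simp add: ruelle_apply_apply algebra_simps sum_distrib_left)
    show "norm (ruelle_apply f \<phi>) \<le> norm \<phi> * (2 * exp (norm f))"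
    proof (rule norm_bound)
      fix x
      have "norm (ruelle_apply f \<phi> x) \<le> (\<Sum>a\<in>UNIV. norm (exp (f (a ## x)) * \<phi> (a ## x)))"
        unfolding ruelle_apply_apply by (rule norm_sum)
      also have "\<dots> \<le> (\<Sum>a\<in>(UNIV::bool set). exp (norm f) * norm \<phi>)"
      proof (rule sum_mono)
        fix a
        have "f (a ## x) \<le> norm f" using norm_bounded[of f "a ## x"] by simp
        then show "norm (exp (f (a ## x)) * \<phi> (a ## x)) \<le> exp (norm f) * norm \<phi>"
          using norm_bounded[of \<phi> "a ## x"] by (auto simp: abs_mult intro!: mult_mono)
      qed
      finally show "norm (ruelle_apply f \<phi> x) \<le> norm \<phi> * (2 * exp (norm f))"
        by (simp add: mult_ac)
    qed
  qed
  then show ?thesis by (simp add: ruelle_def bounded_linear_Blinfun_apply)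
qed

lemma ruelle_eq:
  "apply_bcontfun (blinfun_apply (ruelle f) \<phi>) x =
    exp (f (False ## x)) * \<phi> (False ## x) + exp (f (True ## x)) * \<phi> (True ## x)"
  by (simp add: blinfun_apply_ruelle ruelle_apply_apply UNIV_bool)


section \<open>The spectral radius of a bounded operator on a real normed space\<close>

text \<open>
  As usual for real spaces, the spectrum is that of the complexified operator.  The
  complexification of \<open>X\<close> is \<open>X \<times> X\<close>, where \<open>(u, v)\<close> stands for \<open>u + i v\<close>; its product norm is
  equivalent to every other customary complexification norm, hence gives the same spectrum.
  An inverse of a complex linear operator is complex linear, so it suffices to ask for a
  (real) bounded linear inverse.
\<close>

definition cscale :: "complex \<Rightarrow> 'a::real_normed_vector \<times> 'a \<Rightarrow> 'a \<times> 'a" where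
  "cscale z w = (Re z *\<^sub>R fst w - Im z *\<^sub>R snd w, Re z *\<^sub>R snd w + Im z *\<^sub>R fst w)"

definition complexify :: "('a::real_normed_vector \<Rightarrow>\<^sub>L 'a) \<Rightarrow> 'a \<times> 'a \<Rightarrow> 'a \<times> 'a" where
  "complexify T w = (blinfun_apply T (fst w), blinfun_apply T (snd w))"

definition op_spectrum :: "('a::real_normed_vector \<Rightarrow>\<^sub>L 'a) \<Rightarrow> complex set" where
  "op_spectrum T = {z. \<not> (\<exists>S. bounded_linear S \<and>
     (\<forall>w. S (cscale z w - complexify T w) = w) \<and>
     (\<forall>w. cscale z (S w) - complexify T (S w) = w))}"

definition op_spectral_radius :: "('a::real_normed_vector \<Rightarrow>\<^sub>L 'a) \<Rightarrow> real" where
  "op_spectral_radius T = (SUP z\<in>op_spectrum T. cmod z)"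


section \<open>Brownian motion on the unit interval\<close>

locale brownian_motion_01 = prob_space M + complete_measure M
  for M :: "'w measure" +
  fixes B :: "real \<Rightarrow> 'w \<Rightarrow> real"
  assumes measurable_B: "\<And>s. s \<in> {0..1} \<Longrightarrow> B s \<in> borel_measurable M"
    and start_0: "AE \<omega> in M. B 0 \<omega> = 0"
    and indep_increments: "\<And>(n::nat) s. (\<And>i. i \<le> n \<Longrightarrow> s i \<in> {0..1}) \<Longrightarrow> mono_on {..n} s \<Longrightarrow>
      indep_vars (\<lambda>_. borel) (\<lambda>i \<omega>. B (s (Suc i)) \<omega> - B (s i) \<omega>) {..<n}"
    and normal_increments: "\<And>s u. 0 \<le> s \<Longrightarrow> s < u \<Longrightarrow> u \<le> 1 \<Longrightarrow>
      distributed M lborel (\<lambda>\<omega>. B u \<omega> - B s \<omega>) (normal_density 0 (sqrt (u - s)))"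
    and continuous_paths: "AE \<omega> in M. continuous_on {0..1} (\<lambda>s. B s \<omega>)"


section \<open>The Brownian potential\<close>

definition dyadic :: "bool stream \<Rightarrow> real" where
  "dyadic x = (\<Sum>n. (1/2) ^ Suc n * of_bool (x !! n))"

text \<open>
  The value at \<open>\<omega>\<close> is meaningful whenever the path of \<open>\<omega>\<close> is continuous, see
  \<open>brownian_potential_apply\<close>; on the remaining null set it is an unspecified continuous function.
\<close>

definition brownian_potential :: "(real \<Rightarrow> 'w \<Rightarrow> real) \<Rightarrow> 'w \<Rightarrow> (bool stream \<Rightarrow>\<^sub>C real)" where
  "brownian_potential B \<omega> = Bcontfun (\<lambda>x. B (dyadic x) \<omega>)"

lemma dyadic_in_01: "dyadic x \<in> {0..1}"
proof -
  have le: "norm ((1/2) ^ Suc n * of_bool (x !! n) :: real) \<le> (1/2) ^ Suc n" for n by simp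
  have s: "summable (\<lambda>n. (1/2::real) ^ Suc n)" and t: "(\<Sum>n. (1/2::real) ^ Suc n) = 1"
    using power_half_series by (auto simp: sums_iff)
  have s': "summable (\<lambda>n. (1/2) ^ Suc n * of_bool (x !! n) :: real)"
    by (rule summable_comparison_test[OF _ s]) (use le in blast)
  have "dyadic x \<le> (\<Sum>n. (1/2::real) ^ Suc n)"
    unfolding dyadic_def by (rule suminf_le[OF _ s' s]) simp
  moreover have "0 \<le> dyadic x" unfolding dyadic_def by (rule suminf_nonneg[OF s']) simp
  ultimately show ?thesis using t by simp
qed

lemma continuous_on_dyadic: "continuous_on UNIV dyadic"
proof -
  have c: "continuous_on UNIV (\<lambda>x::bool stream. of_bool (x !! n) :: real)" for n
    unfolding continuous_on_def
  proof
    fix x :: "bool stream"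
    have "\<forall>\<^sub>F y in at x. (of_bool (y !! n) :: real) = of_bool (x !! n)"
      unfolding eventually_at
    proof (intro exI[of _ "(1/2) ^ Suc (Suc n)"] conjI ballI impI)
      fix y assume "y \<noteq> x \<and> dist y x < (1/2) ^ Suc (Suc n)"
      then have "dist y x \<le> (1/2) ^ Suc (Suc n)" by simp
      then have "y !! n = x !! n" unfolding dist_stream_le_iff by simp
      then show "(of_bool (y !! n) :: real) = of_bool (x !! n)" by simp
    qed simp
    then show "((\<lambda>x::bool stream. of_bool (x !! n) :: real) \<longlongrightarrow> of_bool (x !! n)) (at x)"
      by (rule tendsto_eventually)
  qed
  have "uniform_limit UNIV (\<lambda>N x. \<Sum>n<N. (1/2) ^ Suc n * of_bool (x !! n) :: real)
      (\<lambda>x. \<Sum>n. (1/2) ^ Suc n * of_bool (x !! n)) sequentially"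
  proof (rule Weierstrass_m_test)
    show "summable (\<lambda>n. (1/2::real) ^ Suc n)" using power_half_series by (auto simp: sums_iff)
  qed simp
  then have "continuous_on UNIV (\<lambda>x. \<Sum>n. (1/2) ^ Suc n * of_bool (x !! n) :: real)"
    by (rule uniform_limit_theorem[rotated, OF _ sequentially_bot])
      (intro always_eventually allI continuous_on_sum continuous_on_mult continuous_on_const c)
  then show ?thesis by (simp add: dyadic_def[abs_def])
qed

lemma brownian_potential_apply:
  assumes "continuous_on {0..1} (\<lambda>s. B s \<omega>)"
  shows "apply_bcontfun (brownian_potential B \<omega>) = (\<lambda>x. B (dyadic x) \<omega>)"
proof -
  have "continuous_on UNIV (\<lambda>x. B (dyadic x) \<omega>)"
    by (rule continuous_on_compose2[OF assms continuous_on_dyadic]) (use dyadic_in_01 in auto)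
  then show ?thesis
    by (simp add: brownian_potential_def stream_bcontfun_iff Bcontfun_inverse)
qed

definition lambda_B :: "(real \<Rightarrow> 'w \<Rightarrow> real) \<Rightarrow> 'w \<Rightarrow> real" where
  "lambda_B B \<omega> = op_spectral_radius (ruelle (brownian_potential B \<omega>))"

end

theory Submission
  imports Defs
begin

text \<open>
  The spectral radius of the Ruelle operator \<open>L\<close> of a potential \<open>f\<close> is
  \<open>inf\<^sub>n \<parallel>L\<^sup>n 1\<parallel>\<^bsup>1/n\<^esup>\<close>: no larger number lies in the spectrum by the Neumann series, and
  this number lies in it because \<open>L\<close> is positive.  Evaluating at the fixed point
  \<open>(1,1,1,\<dots>)\<close> of the shift, and bounding \<open>L 1\<close>, gives \<open>exp (f (1,1,\<dots>)) \<le> \<lambda> \<le> 2 exp (max f)\<close>.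
  For the Brownian potential the lower bound is \<open>exp B\<^sub>1\<close>, of mean \<open>exp (1/2)\<close>, and by Levy's
  maximal inequality along dyadic partitions the mean of \<open>exp (max B)\<close> is at most twice that of
  \<open>exp B\<^sub>1\<close>.
\<close>

section \<open>Neumann series and the spectrum\<close>

lemma cscale_mult: "cscale (a * b) w = cscale a (cscale b w)"
  by (simp add: cscale_def algebra_simps)

lemma cscale_1 [simp]: "cscale 1 w = w"
  by (simp add: cscale_def)

lemma norm_fst_le_norm: "norm (fst w) \<le> norm w" and norm_snd_le_norm: "norm (snd w) \<le> norm w"
  by (cases w; simp add: norm_fst_le norm_snd_le)+

text \<open>The constant is crude: there are two components with two terms each, and each term is at
  most \<open>cmod c * norm w\<close>.\<close>

lemma norm_cscale_le: "norm (cscale c w) \<le> 4 * cmod c * norm w"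
proof -
  have "norm (cscale c w) \<le> norm (fst (cscale c w)) + norm (snd (cscale c w))"
    by (metis norm_Pair_le prod.collapse)
  also have "\<dots> \<le> (\<bar>Re c\<bar> * norm (fst w) + \<bar>Im c\<bar> * norm (snd w)) +
      (\<bar>Re c\<bar> * norm (snd w) + \<bar>Im c\<bar> * norm (fst w))"
    unfolding cscale_def fst_conv snd_conv
    by (intro add_mono order_trans[OF norm_triangle_ineq4] order_trans[OF norm_triangle_ineq]) simp_all
  also have "\<dots> \<le> (cmod c * norm w + cmod c * norm w) + (cmod c * norm w + cmod c * norm w)"
    by (intro add_mono mult_mono abs_Re_le_cmod abs_Im_le_cmod norm_fst_le_norm norm_snd_le_norm) auto
  finally show ?thesis by simp
qed

lemma bounded_linear_cscale: "bounded_linear (cscale c)"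
  by (rule bounded_linear_intro[where K = "4 * cmod c"])
    (use norm_cscale_le[of c] in \<open>auto simp: cscale_def algebra_simps\<close>)

lemma bounded_linear_complexify: "bounded_linear (complexify T)"
  unfolding complexify_def
  by (intro bounded_linear_Pair bounded_linear_compose[OF blinfun.bounded_linear_right]
      bounded_linear_fst bounded_linear_snd)

lemma complexify_cscale: "complexify T (cscale c w) = cscale c (complexify T w)"
  by (simp add: complexify_def cscale_def blinfun.add_right blinfun.diff_right blinfun.scaleR_right)

lemma complexify_funpow:
  "(complexify T ^^ n) w = ((blinfun_apply T ^^ n) (fst w), (blinfun_apply T ^^ n) (snd w))"
  by (induction n) (simp_all add: complexify_def)

lemma bounded_linear_funpow:
  fixes f :: "'a::real_normed_vector \<Rightarrow> 'a"
  assumes "bounded_linear f"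
  shows "bounded_linear (f ^^ n)"
proof (induction n)
  case (Suc n)
  show ?case using bounded_linear_compose[OF assms Suc] by (simp add: o_def)
qed (simp add: id_def bounded_linear_ident)

text \<open>The inverse of \<open>z - T\<close> is the Neumann series of the terms
  \<open>z^-(n+1) T^n\<close>, which converges geometrically with ratio \<open>r / cmod z\<close>.
  Powers of the complexified operator act componentwise, so bounds on the real powers
  suffice.\<close>

lemma notin_op_spectrum:
  fixes T :: "'a::banach \<Rightarrow>\<^sub>L 'a"
  assumes bound: "\<And>n w. norm ((blinfun_apply T ^^ n) w) \<le> C * r ^ n * norm w"
    and C: "0 \<le> C" and r: "0 \<le> r" "r < cmod z"
  shows "z \<notin> op_spectrum T"
proof -
  define c where "c = inverse z"
  define E where "E = (\<lambda>n w. cscale (c ^ Suc n) ((complexify T ^^ n) w))"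
  define G where "G = (\<lambda>w. cscale z w - complexify T w)"
  have z: "z \<noteq> 0" using r by auto
  have zc: "z * c = 1" using z by (simp add: c_def)
  define q where "q = cmod c * r"
  have q: "0 \<le> q" "q < 1"
    using r z by (auto simp: q_def c_def norm_inverse norm_divide divide_simps)
  \<comment> \<open>The 4 comes from \<open>norm_cscale_le\<close>, a factor 2 from the two
    components, and \<open>cmod c\<close> from the extra power in \<open>c ^ Suc n\<close>.\<close>
  define D where "D = 8 * cmod c * C"
  have bl_pow: "bounded_linear (complexify T ^^ n)" for n
    by (rule bounded_linear_funpow[OF bounded_linear_complexify])
  have blE: "bounded_linear (E n)" for n
    unfolding E_def by (rule bounded_linear_compose[OF bounded_linear_cscale bl_pow])
  have blG: "bounded_linear G"
    unfolding G_def by (intro bounded_linear_sub bounded_linear_cscale bounded_linear_complexify)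
  have Ebound: "norm (E n w) \<le> D * q ^ n * norm w" for n w
  proof -
    have *: "C * r ^ n * norm (fst w) \<le> C * r ^ n * norm w"
      "C * r ^ n * norm (snd w) \<le> C * r ^ n * norm w"
      using C r norm_fst_le_norm[of w] norm_snd_le_norm[of w] by (auto intro!: mult_left_mono)
    have "norm ((complexify T ^^ n) w) \<le> C * r ^ n * norm w + C * r ^ n * norm w"
      unfolding complexify_funpow
      by (rule order_trans[OF norm_Pair_le] add_mono order_trans[OF bound] *)+
    then have "4 * cmod (c ^ Suc n) * norm ((complexify T ^^ n) w)
        \<le> 4 * cmod (c ^ Suc n) * (2 * (C * r ^ n * norm w))"
      by (intro mult_left_mono) (simp_all add: mult_ac)
    then show ?thesis
      using norm_cscale_le[of "c ^ Suc n" "(complexify T ^^ n) w"]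
      by (simp add: E_def D_def q_def norm_mult norm_power power_mult_distrib mult_ac)
  qed
  have sumq: "summable (\<lambda>n. D * q ^ n * norm w)" for w :: "'a \<times> 'a"
    using q by (intro summable_mult2 summable_mult summable_geometric) simp
  have sumE: "summable (\<lambda>n. E n w)" for w
    by (rule summable_comparison_test'[OF sumq[of w], of 0]) (use Ebound in simp)
  define S where "S = (\<lambda>w. \<Sum>n. E n w)"
  have blS: "bounded_linear S"
  proof (rule bounded_linear_intro[where K = "D * (1 / (1 - q))"])
    show "S (x + y) = S x + S y" for x y
      unfolding S_def suminf_add[OF sumE sumE] by (simp add: linear_simps[OF blE])
    show "S (a *\<^sub>R x) = a *\<^sub>R S x" for a x
      unfolding S_def bounded_linear.suminf[OF bounded_linear_scaleR_right sumE] by (simp add: linear_simps[OF blE])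
    show "norm (S w) \<le> norm w * (D * (1 / (1 - q)))" for w
    proof -
      have "norm (S w) \<le> (\<Sum>n. D * q ^ n * norm w)"
        unfolding S_def by (rule norm_suminf_le[OF Ebound sumq])
      also have "\<dots> = D * (1 / (1 - q)) * norm w"
        using q by (subst suminf_mult2[symmetric])
          (auto simp: suminf_mult suminf_geometric summable_mult summable_geometric)
      finally show ?thesis by (simp add: mult_ac)
    qed
  qed
  have pow_cscale: "(complexify T ^^ n) (cscale a w) = cscale a ((complexify T ^^ n) w)" for n a w
    by (induction n) (simp_all add: complexify_cscale)
  \<comment> \<open>Since \<open>z * c = 1\<close>, applying \<open>T\<close> to the
    \<open>n\<close>-th term gives \<open>z\<close> times the next one. The series for
    \<open>G (S w)\<close> therefore telescopes to \<open>z\<close> times its first term, which is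
    \<open>w\<close>.\<close>
  have GE: "G (E n w) = cscale z (E n w) - cscale z (E (Suc n) w)" for n w
    using zc by (simp add: G_def E_def cscale_mult[symmetric] complexify_cscale mult.assoc[symmetric])
  \<comment> \<open>Each term commutes with \<open>G\<close>, so the same telescoping sum also gives
    the left inverse.\<close>
  have EG: "E n (G w) = G (E n w)" for n w
    by (simp add: G_def E_def linear_simps[OF bl_pow] linear_simps[OF bounded_linear_cscale]
        pow_cscale complexify_cscale cscale_mult[symmetric] funpow_swap1 mult_ac)
  have sums: "(\<lambda>n. G (E n w)) sums w" for w
  proof -
    have "(\<lambda>n. cscale z (E n w)) \<longlonglongrightarrow> cscale z 0"
      by (intro bounded_linear.tendsto[OF bounded_linear_cscale] summable_LIMSEQ_zero sumE)
    moreover have "cscale z (0 :: 'a \<times> 'a) = 0" by (simp add: cscale_def zero_prod_def)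
    ultimately have "(\<lambda>n. cscale z (E n w)) \<longlonglongrightarrow> 0" by simp
    from telescope_sums'[OF this] have "(\<lambda>n. G (E n w)) sums cscale z (E 0 w)"
      by (simp only: GE diff_zero)
    moreover have "cscale z (E 0 w) = w" using zc by (simp add: E_def cscale_mult[symmetric])
    ultimately show ?thesis by simp
  qed
  have "S (G w) = w" for w
    using sums_unique[OF sums[of w]] by (simp add: S_def EG)
  moreover have "G (S w) = w" for w
    using sums_unique[OF sums[of w]] bounded_linear.suminf[OF blG sumE[of w]] by (simp add: S_def)
  ultimately show ?thesis
    using blS unfolding op_spectrum_def G_def by blast
qed

section \<open>The spectral radius of the Ruelle operator\<close>

text \<open>Completeness is what \<open>notin_op_spectrum\<close> asks of the space.\<close>

instance bcontfun :: (metric_space, banach) banach ..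

abbreviation ruelle_iter :: "(bool stream \<Rightarrow>\<^sub>C real) \<Rightarrow> nat \<Rightarrow> (bool stream \<Rightarrow>\<^sub>C real) \<Rightarrow> (bool stream \<Rightarrow>\<^sub>C real)"
  where "ruelle_iter f n \<equiv> blinfun_apply (ruelle f) ^^ n"

text \<open>By positivity of \<open>L\<close> this is the operator norm of \<open>L^n\<close>:
  \<open>norm_ruelle_iter_le\<close> gives one inequality, and the constant 1 has norm 1.\<close>

definition ruelle_growth :: "(bool stream \<Rightarrow>\<^sub>C real) \<Rightarrow> nat \<Rightarrow> real" where
  "ruelle_growth f n = norm (ruelle_iter f n (const_bcontfun 1))"

text \<open>Gelfand's formula with an infimum in place of the limit; a countable infimum is also
  convenient for measurability. The index is shifted because \<open>root 0\<close> is constantly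
  0.\<close>

definition ruelle_radius :: "(bool stream \<Rightarrow>\<^sub>C real) \<Rightarrow> real" where
  "ruelle_radius f = (INF n. root (Suc n) (ruelle_growth f (Suc n)))"

section \<open>Positivity and submultiplicative growth of the iterates\<close>

lemma bounded_linear_ruelle_iter: "bounded_linear (ruelle_iter f n)"
  by (rule bounded_linear_funpow) (rule blinfun.bounded_linear_right)

lemma ruelle_iter_mono:
  fixes \<phi> \<psi> :: "bool stream \<Rightarrow>\<^sub>C real"
  assumes "\<And>x. \<phi> x \<le> \<psi> x"
  shows "ruelle_iter f n \<phi> x \<le> ruelle_iter f n \<psi> x"
  using assms
  by (induction n arbitrary: x) (auto simp: ruelle_eq intro!: add_mono mult_left_mono)

text \<open>Positive weights preserve the inequality at each iteration. The sign of \<phi> is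
  arbitrary, which \<open>nonneg_if_ruelle_le\<close> exploits.\<close>

lemma ruelle_iter_le_power:
  fixes \<phi> :: "bool stream \<Rightarrow>\<^sub>C real"
  assumes le: "\<And>x. ruelle f \<phi> x \<le> r * \<phi> x" and r: "0 \<le> r"
  shows "ruelle_iter f n \<phi> x \<le> r ^ n * \<phi> x"
proof (induction n arbitrary: x)
  case (Suc n)
  have "exp (f (a ## x)) * ruelle_iter f n \<phi> (a ## x) \<le> r ^ n * (exp (f (a ## x)) * \<phi> (a ## x))" for a
    using mult_left_mono[OF Suc[of "a ## x"], of "exp (f (a ## x))"] by (simp add: mult_ac)
  from add_mono[OF this this] have "ruelle_iter f (Suc n) \<phi> x \<le> r ^ n * ruelle f \<phi> x"
    by (simp add: ruelle_eq distrib_left)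
  also have "\<dots> \<le> r ^ n * (r * \<phi> x)"
    using le[of x] r by (intro mult_left_mono) auto
  finally show ?case by (simp add: mult_ac)
qed simp

text \<open>\<phi> lies between the constants \<open>- norm \<phi>\<close> and
  \<open>norm \<phi>\<close>, and the iterates are monotone and linear.\<close>

lemma abs_ruelle_iter_le:
  "\<bar>ruelle_iter f n \<phi> x\<bar> \<le> norm \<phi> * ruelle_iter f n (const_bcontfun 1) x"
proof -
  have "ruelle_iter f n ((- norm \<phi>) *\<^sub>R const_bcontfun 1) x \<le> ruelle_iter f n \<phi> x"
    "ruelle_iter f n \<phi> x \<le> ruelle_iter f n (norm \<phi> *\<^sub>R const_bcontfun 1) x"
    using norm_bounded[of \<phi>]
    by (auto intro!: ruelle_iter_mono simp: const_bcontfun.rep_eq abs_le_iff) (metis minus_le_iff)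
  then show ?thesis
    unfolding linear_simps[OF bounded_linear_ruelle_iter] by simp
qed

lemma ruelle_iter_one_nonneg: "0 \<le> ruelle_iter f n (const_bcontfun 1) x"
  using ruelle_iter_mono[of 0 "const_bcontfun 1" n f x]
  by (simp add: linear_simps[OF bounded_linear_ruelle_iter] const_bcontfun.rep_eq)

lemma ruelle_iter_one_le: "ruelle_iter f n (const_bcontfun 1) x \<le> ruelle_growth f n"
  using norm_bounded[of "ruelle_iter f n (const_bcontfun 1)" x] by (simp add: ruelle_growth_def)

lemma norm_ruelle_iter_le: "norm (ruelle_iter f n \<phi>) \<le> ruelle_growth f n * norm \<phi>"
proof (rule norm_bound)
  fix x
  show "norm (ruelle_iter f n \<phi> x) \<le> ruelle_growth f n * norm \<phi>"
    using abs_ruelle_iter_le[of n f \<phi> x] mult_left_mono[OF ruelle_iter_one_le[of n f x], of "norm \<phi>"]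
    by (simp add: mult.commute)
qed

lemma ruelle_growth_add: "ruelle_growth f (m + n) \<le> ruelle_growth f m * ruelle_growth f n"
  using norm_ruelle_iter_le[of m f "ruelle_iter f n (const_bcontfun 1)"]
  by (simp add: ruelle_growth_def funpow_add)

section \<open>The growth rate: lower bound and geometric estimates\<close>

lemma SCons_sconst: "a ## sconst a = sconst a"
  by (metis siterate.ctr id_apply)

text \<open>The point (1,1,...) is its own preimage under prepending 1. Dropping the nonnegative
  term of the other preimage leaves a factor \<open>exp (f (sconst True))\<close> per
  iteration.\<close>

lemma exp_sconst_power_le:
  fixes f :: "bool stream \<Rightarrow>\<^sub>C real"
  shows "exp (f (sconst True)) ^ n \<le> ruelle_iter f n (const_bcontfun 1) (sconst True)"
proof (induction n)
  case (Suc n)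
  have "exp (f (sconst True)) ^ Suc n \<le> exp (f (sconst True)) * ruelle_iter f n (const_bcontfun 1) (sconst True)"
    unfolding power_Suc by (intro mult_left_mono Suc) simp
  also have "\<dots> \<le> ruelle_iter f (Suc n) (const_bcontfun 1) (sconst True)"
    using ruelle_iter_one_nonneg[of n f "False ## sconst True"]
    by (simp only: funpow.simps o_apply ruelle_eq SCons_sconst) simp
  finally show ?case .
qed (simp add: const_bcontfun.rep_eq)

lemma exp_power_le_ruelle_growth:
  fixes f :: "bool stream \<Rightarrow>\<^sub>C real"
  shows "exp (f (sconst True)) ^ n \<le> ruelle_growth f n"
  using exp_sconst_power_le ruelle_iter_one_le order_trans by blast

lemma ruelle_growth_pos: "0 < ruelle_growth f n"
  using exp_power_le_ruelle_growth[of f n] by (meson exp_gt_zero less_le_trans zero_less_power)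

lemma bdd_below_root_ruelle_growth: "bdd_below (range (\<lambda>n. root (Suc n) (ruelle_growth f (Suc n))))"
  using ruelle_growth_pos by (intro bdd_belowI[of _ 0]) (auto intro!: real_root_ge_zero less_imp_le)

lemma exp_le_ruelle_radius:
  fixes f :: "bool stream \<Rightarrow>\<^sub>C real"
  shows "exp (f (sconst True)) \<le> ruelle_radius f"
  unfolding ruelle_radius_def
proof (rule cINF_greatest)
  fix n
  have "root (Suc n) (exp (f (sconst True)) ^ Suc n) \<le> root (Suc n) (ruelle_growth f (Suc n))"
    by (rule real_root_le_mono) (use exp_power_le_ruelle_growth[of f "Suc n"] in simp_all)
  then show "exp (f (sconst True)) \<le> root (Suc n) (ruelle_growth f (Suc n))"
    by (simp add: real_root_power_cancel del: power_Suc)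
qed simp

lemma ruelle_radius_pos: "0 < ruelle_radius f"
  using exp_le_ruelle_radius[of f] by (meson exp_gt_zero less_le_trans)

lemma ruelle_radius_le_growth_1: "ruelle_radius f \<le> ruelle_growth f 1"
  unfolding ruelle_radius_def
  by (rule cINF_lower2[OF bdd_below_root_ruelle_growth, of 0]) auto

lemma ruelle_radius_power_le: "ruelle_radius f ^ n \<le> ruelle_growth f n"
proof (cases n)
  case 0
  then show ?thesis using exp_power_le_ruelle_growth[of f 0] by simp
next
  case (Suc m)
  have "ruelle_radius f \<le> root n (ruelle_growth f n)"
    unfolding ruelle_radius_def Suc by (rule cINF_lower[OF bdd_below_root_ruelle_growth]) simp
  then have "ruelle_radius f ^ n \<le> root n (ruelle_growth f n) ^ n"
    using ruelle_radius_pos[of f] by (intro power_mono) auto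
  then show ?thesis using Suc ruelle_growth_pos[of f n] by (simp add: real_root_pow_pos2 del: power_Suc)
qed

text \<open>Fekete's argument: some \<open>m\<close> has growth below \<open>r ^ m\<close>, and
  submultiplicativity removes blocks of length \<open>m\<close> until fewer than \<open>m\<close>
  steps remain.\<close>

lemma ruelle_growth_le_power:
  assumes "ruelle_radius f < r"
  obtains C where "0 \<le> C" "\<And>n. ruelle_growth f n \<le> C * r ^ n"
proof -
  have r: "0 < r" using assms ruelle_radius_pos[of f] by linarith
  obtain k where k: "root (Suc k) (ruelle_growth f (Suc k)) < r"
    using assms unfolding ruelle_radius_def by (subst (asm) cINF_less_iff) (auto simp: bdd_below_root_ruelle_growth)
  define m where "m = Suc k"
  have "root m (ruelle_growth f m) ^ m < r ^ m"
    using k ruelle_growth_pos[of f m] by (intro power_strict_mono) (auto simp: m_def less_imp_le)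
  then have am: "ruelle_growth f m < r ^ m"
    using ruelle_growth_pos[of f m] by (simp add: m_def real_root_pow_pos2 del: power_Suc)
  \<comment> \<open>The sum dominates each of the finitely many ratios left over for indices below
    \<open>m\<close>.\<close>
  define C where "C = (\<Sum>j<m. ruelle_growth f j / r ^ j)"
  have C: "0 \<le> C" unfolding C_def using r ruelle_growth_pos by (intro sum_nonneg) (auto intro: less_imp_le)
  have "ruelle_growth f n \<le> C * r ^ n" for n
  proof (induction n rule: less_induct)
    case (less n)
    show ?case
    proof (cases "n < m")
      case True
      then have "ruelle_growth f n / r ^ n \<le> C"
        unfolding C_def using r ruelle_growth_pos
        by (intro member_le_sum[where f = "\<lambda>j. ruelle_growth f j / r ^ j"]) (auto intro: less_imp_le)
      then show ?thesis using r by (simp add: pos_divide_le_eq)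
    next
      case False
      have "ruelle_growth f n \<le> ruelle_growth f m * ruelle_growth f (n - m)"
        using ruelle_growth_add[of f m "n - m"] False by simp
      also have "\<dots> \<le> r ^ m * (C * r ^ (n - m))"
        using less[of "n - m"] False am r ruelle_growth_pos[of f m] ruelle_growth_pos[of f "n - m"]
        by (intro mult_mono) (auto simp: m_def less_imp_le)
      also have "\<dots> = C * r ^ n"
        using False by (simp add: power_add[symmetric] mult.left_commute)
      finally show ?thesis .
    qed
  qed
  with C that show ?thesis by blast
qed

text \<open>Otherwise the powers of \<open>ruelle_radius f / r\<close>, bounded by \<open>C\<close>,
  would be unbounded.\<close>

lemma ruelle_radius_leI:
  assumes "\<And>n. ruelle_growth f n \<le> C * r ^ n" "0 < r"
  shows "ruelle_radius f \<le> r"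
proof (rule ccontr)
  assume "\<not> ?thesis"
  then have "1 < ruelle_radius f / r" using assms by simp
  then obtain n where "C < (ruelle_radius f / r) ^ n" using real_arch_pow by blast
  then have "C * r ^ n < ruelle_radius f ^ n"
    using assms(2) by (simp add: power_divide pos_less_divide_eq)
  with assms(1)[of n] ruelle_radius_power_le[of f n] show False by linarith
qed

text \<open>A minimum principle. Iteration gives \<open>L^n \<phi> \<le> r^n \<phi>\<close>, while
  the left side is of order \<open>s^n\<close> for some \<open>s < r\<close>; dividing by
  \<open>r^n\<close> and letting \<open>n\<close> grow leaves \<open>0 \<le> \<phi>\<close>.\<close>

lemma nonneg_if_ruelle_le:
  fixes \<phi> :: "bool stream \<Rightarrow>\<^sub>C real"
  assumes le: "\<And>x. ruelle f \<phi> x \<le> r * \<phi> x" and r: "ruelle_radius f < r"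
  shows "0 \<le> \<phi> x"
proof -
  obtain s where s: "ruelle_radius f < s" "s < r" using r dense by blast
  have s0: "0 < s" using s ruelle_radius_pos[of f] by linarith
  obtain C where C: "0 \<le> C" "\<And>n. ruelle_growth f n \<le> C * s ^ n"
    using ruelle_growth_le_power[OF s(1)] by blast
  have iter: "ruelle_iter f n \<phi> x \<le> r ^ n * \<phi> x" for n
    by (rule ruelle_iter_le_power) (use le s s0 in auto)
  have bd: "- (C * norm \<phi>) * (s / r) ^ n \<le> \<phi> x" for n
  proof -
    have "\<bar>ruelle_iter f n \<phi> x\<bar> \<le> ruelle_growth f n * norm \<phi>"
      using norm_bounded[of "ruelle_iter f n \<phi>" x] norm_ruelle_iter_le[of n f \<phi>] by simp
    also have "\<dots> \<le> C * s ^ n * norm \<phi>" by (intro mult_right_mono C) simp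
    finally have "- (C * s ^ n * norm \<phi>) \<le> r ^ n * \<phi> x" using iter[of n] by linarith
    then show ?thesis using s s0 by (simp add: power_divide divide_simps mult_ac)
  qed
  have "(\<lambda>n. - (C * norm \<phi>) * (s / r) ^ n) \<longlonglongrightarrow> - (C * norm \<phi>) * 0"
    using s s0 by (intro tendsto_intros LIMSEQ_power_zero) simp
  from tendsto_upperbound[OF this] bd show ?thesis by simp
qed

text \<open>
  For a solution \<open>\<phi>\<close> of \<open>(\<rho> - L) \<phi> = 1\<close>, comparison with \<open>r > \<rho>\<close> gives \<open>\<phi> \<ge> 0\<close>, so that
  \<open>L \<phi> = \<rho> \<phi> - 1 \<le> (\<rho> - 1 / \<parallel>\<phi>\<parallel>) \<phi>\<close> would make the iterates grow slower than \<open>\<rho>\<^sup>n\<close>.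
\<close>

lemma ruelle_resolvent_one_neq:
  "ruelle_radius f *\<^sub>R \<phi> - ruelle f \<phi> \<noteq> const_bcontfun 1"
proof
  define \<rho> where "\<rho> = ruelle_radius f"
  have \<rho>: "0 < \<rho>" unfolding \<rho>_def by (rule ruelle_radius_pos)
  assume "ruelle_radius f *\<^sub>R \<phi> - ruelle f \<phi> = const_bcontfun 1"
  then have "(\<rho> *\<^sub>R \<phi> - ruelle f \<phi>) x = 1" for x by (simp add: \<rho>_def const_bcontfun.rep_eq)
  then have eq: "ruelle f \<phi> x = \<rho> * \<phi> x - 1" for x by (simp add: algebra_simps)
  have "\<phi> \<noteq> 0" using eq[of undefined] by (auto simp: blinfun.zero_right)
  then have N: "0 < norm \<phi>" by simp
  have absle: "\<bar>\<phi> x\<bar> \<le> norm \<phi>" for x using norm_bounded[of \<phi> x] by simp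
  have nonneg: "0 \<le> \<phi> x" for x
  proof (rule nonneg_if_ruelle_le)
    \<comment> \<open>This rate works because \<open>\<phi> / norm \<phi>\<close> is at least -1, so
      that \<open>\<rho> \<phi> - 1\<close> is at most
      \<open>\<rho> \<phi> + \<phi> / norm \<phi>\<close>.\<close>
    show "ruelle_radius f < \<rho> + 1 / norm \<phi>" using N by (simp add: \<rho>_def)
    show "ruelle f \<phi> y \<le> (\<rho> + 1 / norm \<phi>) * \<phi> y" for y
      using absle[of y] N by (simp add: eq field_simps abs_le_iff)
  qed
  have Lnonneg: "0 \<le> ruelle f \<phi> x" for x by (simp add: ruelle_eq nonneg)
  \<comment> \<open>This allows the iterates of 1 to be dominated by those of
    \<open>\<rho> \<phi>\<close>.\<close>
  have ge1: "1 \<le> \<rho> * \<phi> x" for x using eq[of x] Lnonneg[of x] by simp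
  \<comment> \<open>The maximum with \<open>\<rho> / 2\<close> keeps \<open>s\<close> positive while
    still below \<rho>.\<close>
  define s where "s = max (\<rho> - 1 / norm \<phi>) (\<rho> / 2)"
  have s: "0 < s" "s < \<rho>" using \<rho> N by (auto simp: s_def)
  have Lle: "ruelle f \<phi> x \<le> s * \<phi> x" for x
  proof -
    have "ruelle f \<phi> x \<le> (\<rho> - 1 / norm \<phi>) * \<phi> x"
      using absle[of x] N nonneg[of x] by (simp add: eq field_simps)
    also have "\<dots> \<le> s * \<phi> x" by (intro mult_right_mono nonneg) (simp add: s_def)
    finally show ?thesis .
  qed
  have iter: "ruelle_iter f n \<phi> x \<le> s ^ n * \<phi> x" for n x
    by (rule ruelle_iter_le_power) (use Lle s in auto)
  have "ruelle_growth f n \<le> \<rho> * norm \<phi> * s ^ n" for n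
    unfolding ruelle_growth_def
  proof (rule norm_bound)
    fix x
    have "norm (ruelle_iter f n (const_bcontfun 1) x) = ruelle_iter f n (const_bcontfun 1) x"
      using ruelle_iter_one_nonneg[of n f x] by simp
    also have "\<dots> \<le> ruelle_iter f n (\<rho> *\<^sub>R \<phi>) x"
      by (rule ruelle_iter_mono) (simp add: const_bcontfun.rep_eq ge1)
    also have "\<dots> = \<rho> * ruelle_iter f n \<phi> x"
      by (simp add: linear_simps[OF bounded_linear_ruelle_iter])
    also have "\<dots> \<le> \<rho> * (s ^ n * norm \<phi>)"
      using iter[of n x] absle[of x] \<rho> s
      by (intro mult_left_mono order_trans[OF iter]) auto
    finally show "norm (ruelle_iter f n (const_bcontfun 1) x) \<le> \<rho> * norm \<phi> * s ^ n"
      by (simp add: mult_ac)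
  qed
  from ruelle_radius_leI[OF this s(1)] s(2) show False by (simp add: \<rho>_def)
qed

text \<open>The first component of the inverse applied to \<open>(1, 0)\<close> would solve the
  excluded equation, since the scalar is real.\<close>

lemma ruelle_radius_in_op_spectrum: "of_real (ruelle_radius f) \<in> op_spectrum (ruelle f)"
proof (rule ccontr)
  assume "\<not> ?thesis"
  then obtain S where
    "\<And>w. cscale (of_real (ruelle_radius f)) (S w) - complexify (ruelle f) (S w) = w"
    unfolding op_spectrum_def by blast
  from arg_cong[OF this[of "(const_bcontfun 1, 0)"], of fst] ruelle_resolvent_one_neq
  show False by (simp add: cscale_def complexify_def)
qed

text \<open>The Neumann series bounds the spectrum, and the bound is attained, so the supremum is a
  maximum.\<close>

lemma op_spectral_radius_ruelle: "op_spectral_radius (ruelle f) = ruelle_radius f"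
proof -
  have le: "cmod z \<le> ruelle_radius f" if "z \<in> op_spectrum (ruelle f)" for z
  proof (rule ccontr)
    assume "\<not> ?thesis"
    then obtain r where r: "ruelle_radius f < r" "r < cmod z" using dense[of "ruelle_radius f" "cmod z"] by (auto simp: not_le)
    have r0: "0 \<le> r" using r ruelle_radius_pos[of f] by linarith
    obtain C where C: "0 \<le> C" "\<And>n. ruelle_growth f n \<le> C * r ^ n"
      using ruelle_growth_le_power[OF r(1)] by blast
    have "norm (ruelle_iter f n w) \<le> C * r ^ n * norm w" for n w
      using norm_ruelle_iter_le[of n f w] mult_right_mono[OF C(2)[of n], of "norm w"] by simp
    from notin_op_spectrum[OF this C(1) r0 r(2)] that show False by blast
  qed
  show ?thesis
    unfolding op_spectral_radius_def
  proof (rule cSup_eq_maximum)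
    have "cmod (of_real (ruelle_radius f)) = ruelle_radius f" using ruelle_radius_pos[of f] by simp
    then show "ruelle_radius f \<in> cmod ` op_spectrum (ruelle f)"
      using ruelle_radius_in_op_spectrum by (metis image_eqI)
  qed (use le in auto)
qed

section \<open>Levy's maximal inequality\<close>

text \<open>Tonelli for the indicator of \<open>0 \<le> u < Y x\<close>. Negative values of
  \<open>Y\<close> are harmless because \<open>ennreal\<close> truncates them to 0.\<close>

lemma (in sigma_finite_measure) nn_integral_layer_cake:
  fixes Y :: "'a \<Rightarrow> real"
  assumes [measurable]: "Y \<in> borel_measurable M"
  shows "(\<integral>\<^sup>+x. ennreal (Y x) \<partial>M) =
    (\<integral>\<^sup>+u. indicator {0..} u * emeasure M {x \<in> space M. u < Y x} \<partial>lborel)"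
proof -
  interpret pair_sigma_finite M lborel ..
  have "(\<integral>\<^sup>+x. ennreal (Y x) \<partial>M) = (\<integral>\<^sup>+x. (\<integral>\<^sup>+u. (if 0 \<le> u \<and> u < Y x then 1 else 0) \<partial>lborel) \<partial>M)"
  proof (rule nn_integral_cong)
    fix x
    have "(\<integral>\<^sup>+u. (if 0 \<le> u \<and> u < Y x then 1 else 0) \<partial>lborel) = (\<integral>\<^sup>+u. indicator {0..<Y x} u \<partial>lborel)"
      by (rule nn_integral_cong) (auto simp: indicator_def)
    then show "ennreal (Y x) = (\<integral>\<^sup>+u. (if 0 \<le> u \<and> u < Y x then 1 else 0) \<partial>lborel)"
      by (cases "0 \<le> Y x") (auto simp: ennreal_neg)
  qed
  also have "\<dots> = (\<integral>\<^sup>+u. (\<integral>\<^sup>+x. (if 0 \<le> u \<and> u < Y x then 1 else 0) \<partial>M) \<partial>lborel)"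
    by (rule Fubini'[symmetric]) measurable
  also have "\<dots> = (\<integral>\<^sup>+u. indicator {0..} u * emeasure M {x \<in> space M. u < Y x} \<partial>lborel)"
  proof (rule nn_integral_cong)
    fix u :: real
    have "(\<integral>\<^sup>+x. (if 0 \<le> u \<and> u < Y x then 1 else 0) \<partial>M) =
        (\<integral>\<^sup>+x. indicator {0..} u * indicator {x \<in> space M. u < Y x} x \<partial>M)"
      by (rule nn_integral_cong) (auto simp: indicator_def)
    then show "(\<integral>\<^sup>+x. (if 0 \<le> u \<and> u < Y x then 1 else 0) \<partial>M) =
        indicator {0..} u * emeasure M {x \<in> space M. u < Y x}"
      by (simp add: nn_integral_cmult)
  qed
  finally show ?thesis .
qed

text \<open>Passes from Levy's tail inequality to expectations with the same constant.\<close>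

lemma (in sigma_finite_measure) nn_integral_le_if_tails_le:
  fixes Y Z :: "'a \<Rightarrow> real"
  assumes [measurable]: "Y \<in> borel_measurable M" "Z \<in> borel_measurable M"
    and "\<And>u. 0 \<le> u \<Longrightarrow> emeasure M {x \<in> space M. u < Y x} \<le> c * emeasure M {x \<in> space M. u < Z x}"
  shows "(\<integral>\<^sup>+x. ennreal (Y x) \<partial>M) \<le> c * (\<integral>\<^sup>+x. ennreal (Z x) \<partial>M)"
proof -
  have "(\<integral>\<^sup>+x. ennreal (Y x) \<partial>M) \<le>
      (\<integral>\<^sup>+u. c * (indicator {0..} u * emeasure M {x \<in> space M. u < Z x}) \<partial>lborel)"
    unfolding nn_integral_layer_cake[OF assms(1)]
    by (rule nn_integral_mono) (use assms(3) in \<open>auto simp: indicator_def\<close>)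
  also have "\<dots> = c * (\<integral>\<^sup>+x. ennreal (Z x) \<partial>M)"
    unfolding nn_integral_layer_cake[OF assms(2)] by (rule nn_integral_cmult) measurable
  finally show ?thesis .
qed

text \<open>Decompose by the first time the partial sums exceed \<open>a\<close>. Independently of
  the past, the remaining increments have nonnegative sum with probability at least 1/2, and then
  the final sum exceeds \<open>a\<close> too.\<close>

lemma (in prob_space) levy_maximal_inequality:
  fixes X :: "nat \<Rightarrow> 'a \<Rightarrow> real"
  assumes indep: "indep_vars (\<lambda>_. borel) X {..<n}"
    and half: "\<And>k. k \<le> n \<Longrightarrow> 1/2 \<le> prob {\<omega> \<in> space M. 0 \<le> (\<Sum>i\<in>{k..<n}. X i \<omega>)}"
  shows "prob {\<omega> \<in> space M. \<exists>k\<le>n. a < (\<Sum>i<k. X i \<omega>)} \<le> 2 * prob {\<omega> \<in> space M. a < (\<Sum>i<n. X i \<omega>)}"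
proof -
  \<comment> \<open>\<open>A k\<close> is first passage above \<open>a\<close> at time
    \<open>k\<close>; \<open>R k\<close> below says that the walk ends no lower than it stands at
    time \<open>k\<close>.\<close>
  define A where "A = (\<lambda>k. {\<omega> \<in> space M. a < (\<Sum>i<k. X i \<omega>) \<and> (\<forall>j<k. (\<Sum>i<j. X i \<omega>) \<le> a)})"
  define R where "R = (\<lambda>k. {\<omega> \<in> space M. 0 \<le> (\<Sum>i\<in>{k..<n}. X i \<omega>)})"
  have X: "X i \<in> borel_measurable M" if "i < n" for i
    using indep that by (auto simp: indep_vars_def)
  have S: "(\<lambda>\<omega>. \<Sum>i<k. X i \<omega>) \<in> borel_measurable M" if "k \<le> n" for k
    using that by (intro borel_measurable_sum X) auto
  have T: "(\<lambda>\<omega>. \<Sum>i\<in>{k..<n}. X i \<omega>) \<in> borel_measurable M" for k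
    by (intro borel_measurable_sum X) auto
  have A_sets: "A k \<in> events" if "k \<le> n" for k
  proof -
    have [measurable]: "(\<lambda>\<omega>. \<Sum>i<k. X i \<omega>) \<in> borel_measurable M" by (rule S[OF that])
    have "{\<omega> \<in> space M. (\<Sum>i<j. X i \<omega>) \<le> a} \<in> events" if "j < k" for j
    proof -
      have [measurable]: "(\<lambda>\<omega>. \<Sum>i<j. X i \<omega>) \<in> borel_measurable M" using S \<open>k \<le> n\<close> \<open>j < k\<close> by simp
      show ?thesis by measurable
    qed
    then have "{\<omega> \<in> space M. \<forall>j\<in>{..<k}. (\<Sum>i<j. X i \<omega>) \<le> a} \<in> events"
      by (intro sets.sets_Collect_finite_All) auto
    moreover have "{\<omega> \<in> space M. a < (\<Sum>i<k. X i \<omega>)} \<in> events" by measurable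
    ultimately have "{\<omega> \<in> space M. a < (\<Sum>i<k. X i \<omega>)} \<inter> {\<omega> \<in> space M. \<forall>j\<in>{..<k}. (\<Sum>i<j. X i \<omega>) \<le> a} \<in> events"
      by auto
    also have "{\<omega> \<in> space M. a < (\<Sum>i<k. X i \<omega>)} \<inter> {\<omega> \<in> space M. \<forall>j\<in>{..<k}. (\<Sum>i<j. X i \<omega>) \<le> a} = A k"
      by (auto simp: A_def)
    finally show ?thesis .
  qed
  have R_sets: "R k \<in> events" for k
    using T[of k] unfolding R_def by measurable
  \<comment> \<open>\<open>A k\<close> depends on the increments before \<open>k\<close> and
    \<open>R k\<close> on those from \<open>k\<close> on. Both are written as preimages under
    restrictions to disjoint index blocks, which are independent.\<close>
  have indep_AR: "prob (A k \<inter> R k) = prob (A k) * prob (R k)" if k: "k \<le> n" for k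
  proof -
    let ?P = "PiM {..<k} (\<lambda>_. borel :: real measure)" and ?Q = "PiM {k..<n} (\<lambda>_. borel :: real measure)"
    define A' where "A' = {f \<in> space ?P. a < (\<Sum>i<k. f i) \<and> (\<forall>j\<in>{..<k}. (\<Sum>i<j. f i) \<le> a)}"
    define R' where "R' = {f \<in> space ?Q. 0 \<le> (\<Sum>i\<in>{k..<n}. f i)}"
    have ind: "indep_var ?P (\<lambda>\<omega>. restrict (\<lambda>i. X i \<omega>) {..<k}) ?Q (\<lambda>\<omega>. restrict (\<lambda>i. X i \<omega>) {k..<n})"
      using k by (intro indep_var_restrict[OF indep]) auto
    have SP: "(\<lambda>f. \<Sum>i<j. f i) \<in> borel_measurable ?P" if "j \<le> k" for j
      using that by (intro borel_measurable_sum measurable_component_singleton) auto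
    have SQ: "(\<lambda>f. \<Sum>i\<in>{k..<n}. f i) \<in> borel_measurable ?Q"
      by (intro borel_measurable_sum measurable_component_singleton) auto
    have "{f \<in> space ?P. (\<Sum>i<j. f i) \<le> a} \<in> sets ?P" if "j < k" for j
    proof -
      have [measurable]: "(\<lambda>f. \<Sum>i<j. f i) \<in> borel_measurable ?P" using SP \<open>j < k\<close> by simp
      show ?thesis by measurable
    qed
    then have "{f \<in> space ?P. \<forall>j\<in>{..<k}. (\<Sum>i<j. f i) \<le> a} \<in> sets ?P"
      by (intro sets.sets_Collect_finite_All) auto
    moreover have "{f \<in> space ?P. a < (\<Sum>i<k. f i)} \<in> sets ?P"
      using SP[of k] by measurable
    ultimately have A': "A' \<in> sets ?P"
      unfolding A'_def by (intro sets.sets_Collect_conj)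
    have R': "R' \<in> sets ?Q"
      using SQ unfolding R'_def by measurable
    have "(\<lambda>\<omega>. restrict (\<lambda>i. X i \<omega>) {..<k}) -` A' \<inter> space M = A k"
      by (auto simp: A'_def A_def space_PiM)
    moreover have "(\<lambda>\<omega>. restrict (\<lambda>i. X i \<omega>) {k..<n}) -` R' \<inter> space M = R k"
      by (auto simp: R'_def R_def space_PiM)
    moreover have "(\<lambda>\<omega>. (restrict (\<lambda>i. X i \<omega>) {..<k}, restrict (\<lambda>i. X i \<omega>) {k..<n})) -` (A' \<times> R') \<inter> space M
        = ((\<lambda>\<omega>. restrict (\<lambda>i. X i \<omega>) {..<k}) -` A' \<inter> space M) \<inter> ((\<lambda>\<omega>. restrict (\<lambda>i. X i \<omega>) {k..<n}) -` R' \<inter> space M)"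
      by auto
    ultimately show ?thesis using indep_varD[OF ind A' R'] by simp
  qed
  have disj: "disjoint_family_on A {..n}"
    unfolding disjoint_family_on_def A_def by (auto simp: not_less[symmetric]) (metis linorder_neqE_nat not_less)
  have "{\<omega> \<in> space M. \<exists>k\<le>n. a < (\<Sum>i<k. X i \<omega>)} = (\<Union>k\<in>{..n}. A k)"
  proof (intro set_eqI iffI)
    fix \<omega> assume "\<omega> \<in> {\<omega> \<in> space M. \<exists>k\<le>n. a < (\<Sum>i<k. X i \<omega>)}"
    then obtain k where k: "\<omega> \<in> space M" "k \<le> n" "a < (\<Sum>i<k. X i \<omega>)" by auto
    define l where "l = (LEAST k. a < (\<Sum>i<k. X i \<omega>))"
    have "a < (\<Sum>i<l. X i \<omega>)" "l \<le> k" unfolding l_def using k(3) by (auto intro: LeastI Least_le)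
    moreover have "(\<Sum>i<j. X i \<omega>) \<le> a" if "j < l" for j
      using not_less_Least[OF that[unfolded l_def]] by simp
    ultimately show "\<omega> \<in> (\<Union>k\<in>{..n}. A k)" using k by (auto simp: A_def intro!: exI[of _ l])
  qed (auto simp: A_def)
  then have "prob {\<omega> \<in> space M. \<exists>k\<le>n. a < (\<Sum>i<k. X i \<omega>)} = (\<Sum>k\<le>n. prob (A k))"
    using A_sets disj by (simp add: finite_measure_finite_Union image_subset_iff)
  also have "\<dots> \<le> (\<Sum>k\<le>n. 2 * prob (A k \<inter> R k))"
  proof (rule sum_mono)
    fix k assume k: "k \<in> {..n}"
    then have "prob (A k) * (1/2) \<le> prob (A k) * prob (R k)"
      using half[of k] by (intro mult_left_mono) (auto simp: R_def)
    then show "prob (A k) \<le> 2 * prob (A k \<inter> R k)" using k by (simp add: indep_AR)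
  qed
  also have "\<dots> = 2 * prob (\<Union>k\<in>{..n}. A k \<inter> R k)"
  proof -
    have "disjoint_family_on (\<lambda>k. A k \<inter> R k) {..n}"
      using disj unfolding disjoint_family_on_def by blast
    then show ?thesis using A_sets R_sets
      by (subst finite_measure_finite_Union) (auto simp: sum_distrib_left)
  qed
  also have "\<dots> \<le> 2 * prob {\<omega> \<in> space M. a < (\<Sum>i<n. X i \<omega>)}"
  proof -
    have "(\<Sum>i<k. X i \<omega>) + (\<Sum>i\<in>{k..<n}. X i \<omega>) = (\<Sum>i<n. X i \<omega>)" if "k \<le> n" for k \<omega>
      using that sum.atLeastLessThan_concat[of 0 k n "\<lambda>i. X i \<omega>"] by (simp add: lessThan_atLeast0)
    then have "(\<Union>k\<in>{..n}. A k \<inter> R k) \<subseteq> {\<omega> \<in> space M. a < (\<Sum>i<n. X i \<omega>)}"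
      unfolding A_def R_def by (auto, smt (verit))
    moreover have "{\<omega> \<in> space M. a < (\<Sum>i<n. X i \<omega>)} \<in> events" using S[of n] by measurable
    ultimately show ?thesis by (simp add: finite_measure_mono)
  qed
  finally show ?thesis .
qed

section \<open>Exponential moments of Brownian motion\<close>

text \<open>By symmetry \<open>X\<close> and \<open>- X\<close> are nonnegative with equal
  probability, and these two events cover the space.\<close>

lemma (in prob_space) prob_centered_normal_nonneg:
  assumes X: "distributed M lborel X (normal_density 0 \<sigma>)" and \<sigma>: "0 < \<sigma>"
  shows "1/2 \<le> prob {\<omega> \<in> space M. 0 \<le> X \<omega>}"
proof -
  have [measurable]: "X \<in> borel_measurable M" using distributed_measurable[OF X] by simp
  have X': "distributed M lborel (\<lambda>\<omega>. - X \<omega>) (normal_density 0 \<sigma>)"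
    using normal_density_affine[OF X \<sigma>, of "-1" 0] by simp
  have eq: "emeasure M (X -` {0..} \<inter> space M) = emeasure M ((\<lambda>\<omega>. - X \<omega>) -` {0..} \<inter> space M)"
    unfolding distributed_emeasure[OF X, of "{0..}", simplified]
      distributed_emeasure[OF X', of "{0..}", simplified] ..
  have "1 = prob ((X -` {0..} \<inter> space M) \<union> ((\<lambda>\<omega>. - X \<omega>) -` {0..} \<inter> space M))"
    by (subst prob_space[symmetric], rule arg_cong[where f = prob]) auto
  also have "\<dots> \<le> prob (X -` {0..} \<inter> space M) + prob ((\<lambda>\<omega>. - X \<omega>) -` {0..} \<inter> space M)"
    by (rule measure_Un_le) measurable
  also have "\<dots> = 2 * prob (X -` {0..} \<inter> space M)"
    using eq by (simp add: measure_def)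
  also have "X -` {0..} \<inter> space M = {\<omega> \<in> space M. 0 \<le> X \<omega>}" by auto
  finally show ?thesis by simp
qed

text \<open>Completing the square turns the weighted density into \<open>exp (1/2)\<close> times the
  normal density with mean 1.\<close>

lemma (in prob_space) nn_integral_exp_std_normal:
  assumes X: "distributed M lborel X (normal_density 0 1)"
  shows "(\<integral>\<^sup>+\<omega>. ennreal (exp (X \<omega>)) \<partial>M) = ennreal (exp (1/2))"
proof -
  have "(\<integral>\<^sup>+\<omega>. ennreal (exp (X \<omega>)) \<partial>M) =
      (\<integral>\<^sup>+x. ennreal (normal_density 0 1 x) * ennreal (exp x) \<partial>lborel)"
    by (rule distributed_nn_integral[OF X, symmetric]) measurable
  also have "\<dots> = (\<integral>\<^sup>+x. ennreal (exp (1/2)) * ennreal (normal_density 1 1 x) \<partial>lborel)"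
  proof (rule nn_integral_cong)
    fix x :: real
    have "x - x\<^sup>2 / 2 = 1/2 - (x - 1)\<^sup>2 / 2" by (simp add: power2_eq_square field_simps)
    then have "exp (- (x\<^sup>2) / 2) * exp x = exp (1/2) * exp (- ((x - 1)\<^sup>2) / 2)"
      by (simp add: exp_add[symmetric])
    then have "normal_density 0 1 x * exp x = exp (1/2) * normal_density 1 1 x"
      by (simp add: normal_density_def field_simps)
    then show "ennreal (normal_density 0 1 x) * ennreal (exp x) =
        ennreal (exp (1/2)) * ennreal (normal_density 1 1 x)"
      by (simp add: ennreal_mult[symmetric])
  qed
  also have "\<dots> = ennreal (exp (1/2)) * (\<integral>\<^sup>+x. ennreal (normal_density 1 1 x) \<partial>lborel)"
    by (rule nn_integral_cmult) measurable
  also have "(\<integral>\<^sup>+x. ennreal (normal_density 1 1 x) \<partial>lborel) = 1"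
    using prob_space.emeasure_space_1[OF prob_space_normal_density[of 1 1]]
    by (simp add: emeasure_density)
  finally show ?thesis by simp
qed

lemma (in brownian_motion_01) measurable_exp_increment:
  assumes "s \<in> {0..1}" "u \<in> {0..1}"
  shows "(\<lambda>\<omega>. exp (B u \<omega> - B s \<omega>)) \<in> borel_measurable M"
proof -
  note [measurable] = assms[THEN measurable_B]
  show ?thesis by measurable
qed

text \<open>Levy's inequality for the increments on the grid, at thresholds \<open>ln u\<close>, is
  integrated over \<open>u\<close>. \<open>B 0\<close> is subtracted since it vanishes only almost
  surely.\<close>

lemma (in brownian_motion_01) nn_integral_Max_exp_le:
  assumes N: "0 < N"
  shows "(\<integral>\<^sup>+\<omega>. ennreal (MAX k\<in>{..N}. exp (B (real k / real N) \<omega> - B 0 \<omega>)) \<partial>M) \<le> 2 * ennreal (exp (1/2))"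
proof -
  define s where "s = (\<lambda>i::nat. real i / real N)"
  define X where "X = (\<lambda>i \<omega>. B (s (Suc i)) \<omega> - B (s i) \<omega>)"
  have s0: "s 0 = 0" and sN: "s N = 1" using N by (auto simp: s_def)
  have s01: "s i \<in> {0..1}" if "i \<le> N" for i using that N by (auto simp: s_def)
  have mono: "mono_on {..N} s" using N by (auto simp: s_def intro!: mono_onI divide_right_mono)
  have sumX: "(\<Sum>i\<in>{j..<k}. X i \<omega>) = B (s k) \<omega> - B (s j) \<omega>" if "j \<le> k" for j k \<omega>
    unfolding X_def using sum_Suc_diff'[OF that, of "\<lambda>i. B (s i) \<omega>"] by simp
  have sumX0: "(\<Sum>i<k. X i \<omega>) = B (s k) \<omega> - B 0 \<omega>" for k \<omega>
    using sumX[of 0 k \<omega>] by (simp add: lessThan_atLeast0 s0)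
  have indep: "indep_vars (\<lambda>_. borel) X {..<N}"
    unfolding X_def using indep_increments[of N s] s01 mono by simp
  have half: "1/2 \<le> prob {\<omega> \<in> space M. 0 \<le> (\<Sum>i\<in>{k..<N}. X i \<omega>)}" if k: "k \<le> N" for k
  proof (cases "k = N")
    \<comment> \<open>The sum is empty here; \<open>normal_increments\<close> covers only intervals
      of positive length.\<close>
    case True
    then show ?thesis by (simp add: prob_space)
  next
    case False
    with k have "s k < 1" "0 \<le> s k" by (auto simp: s_def)
    then have "1/2 \<le> prob {\<omega> \<in> space M. 0 \<le> B 1 \<omega> - B (s k) \<omega>}"
      by (intro prob_centered_normal_nonneg[OF normal_increments]) auto
    then show ?thesis by (simp add: sumX[OF k] sN)
  qed
  note levy = levy_maximal_inequality[OF indep half, unfolded sumX0 sN]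
  let ?Y = "\<lambda>\<omega>. MAX k\<in>{..N}. exp (B (s k) \<omega> - B 0 \<omega>)" and ?Z = "\<lambda>\<omega>. exp (B 1 \<omega> - B 0 \<omega>)"
  have Zm: "?Z \<in> borel_measurable M"
    by (rule measurable_exp_increment) auto
  have Ym: "?Y \<in> borel_measurable M"
    by (rule borel_measurable_Max) (use s01 in \<open>auto intro!: measurable_exp_increment simp del: atLeastAtMost_iff\<close>, simp)
  have "(\<integral>\<^sup>+\<omega>. ennreal (?Y \<omega>) \<partial>M) \<le> 2 * (\<integral>\<^sup>+\<omega>. ennreal (?Z \<omega>) \<partial>M)"
  proof (rule nn_integral_le_if_tails_le[OF Ym Zm])
    fix u :: real assume "0 \<le> u"
    have gr: "u < ?Y \<omega> \<longleftrightarrow> (\<exists>k\<le>N. u < exp (B (s k) \<omega> - B 0 \<omega>))" for \<omega>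
      by (subst Max_gr_iff) auto
    show "emeasure M {\<omega> \<in> space M. u < ?Y \<omega>} \<le> 2 * emeasure M {\<omega> \<in> space M. u < ?Z \<omega>}"
    \<comment> \<open>At \<open>u = 0\<close> there is no logarithmic threshold, but the right-hand
      event is the whole space.\<close>
    proof (cases "u = 0")
      case True
      then show ?thesis by (intro order_trans[OF measure_le_1]) (simp add: emeasure_space_1)
    next
      case False
      with \<open>0 \<le> u\<close> have u: "u < exp x \<longleftrightarrow> ln u < x" for x
        by (metis exp_less_cancel_iff exp_ln order_le_less)
      show ?thesis
        unfolding gr u using levy[of "ln u"] by (simp add: emeasure_eq_measure ennreal_mult[symmetric] ennreal_leI flip: ennreal_numeral)
    qed
  qed
  also have "(\<integral>\<^sup>+\<omega>. ennreal (?Z \<omega>) \<partial>M) = ennreal (exp (1/2))"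
    by (rule nn_integral_exp_std_normal) (use normal_increments[of 0 1] in simp)
  finally show ?thesis by (simp add: s_def)
qed

text \<open>\<open>Y\<close> is the supremum of the dyadic grid maxima. Refining grids makes them
  increase, so monotone convergence keeps the bound; path continuity extends the domination from
  dyadic times to all times.\<close>

lemma (in brownian_motion_01) obtain_path_bound:
  obtains Y :: "'w \<Rightarrow> ennreal" where "Y \<in> borel_measurable M"
    "(\<integral>\<^sup>+\<omega>. Y \<omega> \<partial>M) \<le> 2 * ennreal (exp (1/2))"
    "AE \<omega> in M. \<forall>s\<in>{0..1}. ennreal (exp (B s \<omega>)) \<le> Y \<omega>"
proof -
  define D where "D n \<omega> = (MAX k\<in>{..2 ^ n}. exp (B (real k / 2 ^ n) \<omega> - B 0 \<omega>))" for n \<omega>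
  define Y where "Y = (\<lambda>\<omega>. SUP n. ennreal (D n \<omega>))"
  have dy: "real k / 2 ^ n \<in> {0..1}" if "k \<le> 2 ^ n" for k n
    using that by (auto simp: divide_le_eq_1 simp flip: of_nat_le_iff)
  have Dm: "D n \<in> borel_measurable M" for n
    unfolding D_def
    by (rule borel_measurable_Max) (auto intro!: measurable_exp_increment dy simp del: atLeastAtMost_iff, simp)
  have Dle: "exp (B (real k / 2 ^ n) \<omega> - B 0 \<omega>) \<le> D n \<omega>" if "k \<le> 2 ^ n" for k n \<omega>
    unfolding D_def using that by (intro Max_ge) auto
  have inc: "incseq (\<lambda>n \<omega>. ennreal (D n \<omega>))"
  proof (intro incseq_SucI le_funI ennreal_leI)
    fix n \<omega>
    have "exp (B (real k / 2 ^ n) \<omega> - B 0 \<omega>) \<le> D (Suc n) \<omega>" if "k \<le> 2 ^ n" for k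
      \<comment> \<open>The point \<open>k / 2^n\<close> reappears on the finer grid as
        \<open>2k / 2^(n+1)\<close>.\<close>
      using Dle[of "2 * k" "Suc n" \<omega>] that by simp
    then show "D n \<omega> \<le> D (Suc n) \<omega>"
      unfolding D_def[of n \<omega>] by (subst Max_le_iff) auto
  qed
  have "(\<integral>\<^sup>+\<omega>. Y \<omega> \<partial>M) = (SUP n. \<integral>\<^sup>+\<omega>. ennreal (D n \<omega>) \<partial>M)"
    unfolding Y_def using inc Dm by (intro nn_integral_monotone_convergence_SUP) auto
  also have "\<dots> \<le> 2 * ennreal (exp (1/2))"
    using nn_integral_Max_exp_le[of "2 ^ n" for n] by (intro SUP_least) (simp add: D_def)
  finally have int: "(\<integral>\<^sup>+\<omega>. Y \<omega> \<partial>M) \<le> 2 * ennreal (exp (1/2))" .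
  have "AE \<omega> in M. \<forall>s\<in>{0..1}. ennreal (exp (B s \<omega>)) \<le> Y \<omega>"
    using start_0 continuous_paths
  proof eventually_elim
    fix \<omega> assume B0: "B 0 \<omega> = 0" and cont: "continuous_on {0..1} (\<lambda>s. B s \<omega>)"
    show "\<forall>s\<in>{0..1}. ennreal (exp (B s \<omega>)) \<le> Y \<omega>"
    proof
      fix s :: real assume s: "s \<in> {0..1}"
      \<comment> \<open>Rounding down gives dyadic points within \<open>2^-n\<close> below
        \<open>s\<close>.\<close>
      define k where "k = (\<lambda>n. nat \<lfloor>2 ^ n * s\<rfloor>)"
      define q where "q = (\<lambda>n::nat. real (k n) / 2 ^ n)"
      have k: "real (k n) \<le> 2 ^ n * s" "2 ^ n * s < real (k n) + 1" for n
        using s unfolding k_def by (auto simp: of_nat_nat)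
      have k2: "k n \<le> 2 ^ n" for n
      proof -
        have "real (k n) \<le> 2 ^ n * 1"
          using s by (intro order_trans[OF k(1) mult_left_mono]) auto
        then have "real (k n) \<le> real (2 ^ n)" by simp
        then show ?thesis by (simp only: of_nat_le_iff)
      qed
      have q01: "q n \<in> {0..1}" for n
        unfolding q_def by (rule dy[OF k2])
      have "q \<longlonglongrightarrow> s"
      proof (rule tendsto_sandwich)
        show "\<forall>\<^sub>F n in sequentially. s - (1/2) ^ n \<le> q n"
        proof (intro always_eventually allI)
          fix n
          have "(s - (1/2) ^ n) * 2 ^ n = 2 ^ n * s - 1"
            by (simp add: power_divide field_simps)
          then show "s - (1/2) ^ n \<le> q n"
            using k(2)[of n] by (simp add: q_def pos_le_divide_eq)
        qed
        show "\<forall>\<^sub>F n in sequentially. q n \<le> s"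
          using k(1) by (intro always_eventually) (auto simp: q_def field_simps)
        have "(\<lambda>n. s - (1/2) ^ n) \<longlonglongrightarrow> s - 0"
          by (intro tendsto_intros LIMSEQ_power_zero) simp
        then show "(\<lambda>n. s - (1/2) ^ n) \<longlonglongrightarrow> s" by simp
      qed simp
      then have "(\<lambda>n. B (q n) \<omega>) \<longlonglongrightarrow> B s \<omega>"
        using cont q01 s by (intro continuous_on_tendsto_compose[OF cont]) auto
      then have "(\<lambda>n. ennreal (exp (B (q n) \<omega>))) \<longlonglongrightarrow> ennreal (exp (B s \<omega>))"
        by (intro tendsto_ennrealI tendsto_exp)
      moreover have "ennreal (exp (B (q n) \<omega>)) \<le> Y \<omega>" for n
        using Dle[OF k2, of n \<omega>] unfolding Y_def
        by (intro SUP_upper2[of n] ennreal_leI) (auto simp: q_def B0)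
      ultimately show "ennreal (exp (B s \<omega>)) \<le> Y \<omega>"
        by (blast intro: LIMSEQ_le_const2)
    qed
  qed
  moreover have "Y \<in> borel_measurable M" unfolding Y_def using Dm by measurable
  ultimately show ?thesis using int that by blast
qed

section \<open>Measurability of the spectral radius\<close>

text \<open>Completeness handles the null set of discontinuous paths, where the potential is
  unspecified.\<close>

lemma (in complete_measure) borel_measurable_AE_cong:
  assumes f: "f \<in> borel_measurable M" and ae: "AE x in M. f x = g x"
  shows "g \<in> borel_measurable M"
proof (rule measurableI)
  fix A :: "'b set" assume "A \<in> sets borel"
  with f have *: "f -` A \<inter> space M \<in> sets M" by (rule measurable_sets)
  have "AE x in M. x \<in> f -` A \<inter> space M \<longleftrightarrow> x \<in> g -` A \<inter> space M"
    using ae by eventually_elim auto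
  from in_sets_AE[OF this *] show "g -` A \<inter> space M \<in> sets M" by simp
qed simp

lemma LIMSEQ_stake_shift: "(\<lambda>n. stake n x @- y) \<longlonglongrightarrow> x" for x y :: "'a stream"
proof (rule metric_LIMSEQ_I)
  fix e :: real assume "0 < e"
  then obtain m where m: "(1/2::real) ^ m < e" using real_arch_pow_inv[of e "1/2"] by auto
  have "dist (stake n x @- y) x < e" if "m \<le> n" for n
  proof -
    have "dist (stake n x @- y) x \<le> (1/2) ^ Suc n"
      unfolding dist_stream_le_iff by (simp add: shift_snth)
    also have "\<dots> \<le> (1/2) ^ m" using that by (intro power_decreasing) auto
    finally show ?thesis using m by simp
  qed
  then show "\<exists>m. \<forall>n\<ge>m. dist (stake n x @- y) x < e" by blast
qed

text \<open>Sequences ending in zeros are dense and indexed by the countably many finite words, so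
  the norm becomes a countable supremum and measurability can be checked pointwise.\<close>

lemma ruelle_growth_eq_SUP:
  "ruelle_growth f n = (SUP u. ruelle_iter f n (const_bcontfun 1) (u @- sconst False))"
proof (rule antisym)
  let ?g = "ruelle_iter f n (const_bcontfun 1)"
  have bdd: "bdd_above (range (\<lambda>u. ?g (u @- sconst False)))"
    using ruelle_iter_one_le by (intro bdd_aboveI2)
  show "ruelle_growth f n \<le> (SUP u. ?g (u @- sconst False))"
    unfolding ruelle_growth_def
  proof (rule norm_bound)
    fix x
    have "(\<lambda>n. ?g (stake n x @- sconst False)) \<longlonglongrightarrow> ?g x"
      by (rule continuous_on_tendsto_compose[OF continuous_on_apply_bcontfun[of UNIV] LIMSEQ_stake_shift]) auto
    moreover have "?g (stake n x @- sconst False) \<le> (SUP u. ?g (u @- sconst False))" for n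
      by (rule cSUP_upper[OF _ bdd]) simp
    ultimately have "?g x \<le> (SUP u. ?g (u @- sconst False))"
      by (intro LIMSEQ_le_const2) auto
    then show "norm (?g x) \<le> (SUP u. ?g (u @- sconst False))"
      using ruelle_iter_one_nonneg[of n f x] by simp
  qed
  show "(SUP u. ?g (u @- sconst False)) \<le> ruelle_growth f n"
    by (rule cSUP_least) (auto intro: ruelle_iter_one_le)
qed

lemma (in brownian_motion_01) measurable_brownian_potential:
  "(\<lambda>\<omega>. apply_bcontfun (brownian_potential B \<omega>) x) \<in> borel_measurable M"
proof (rule borel_measurable_AE_cong[OF measurable_B[OF dyadic_in_01]])
  show "AE \<omega> in M. B (dyadic x) \<omega> = apply_bcontfun (brownian_potential B \<omega>) x"
    using continuous_paths by eventually_elim (simp add: brownian_potential_apply)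
qed

lemma (in brownian_motion_01) measurable_ruelle_iter_one:
  "(\<lambda>\<omega>. apply_bcontfun (ruelle_iter (brownian_potential B \<omega>) n (const_bcontfun 1)) x)
    \<in> borel_measurable M"
proof (induction n arbitrary: x)
  case (Suc n)
  note [measurable] = Suc measurable_brownian_potential
  show ?case by (simp add: ruelle_eq)
qed (simp add: const_bcontfun.rep_eq)

lemma (in brownian_motion_01) measurable_ruelle_growth:
  "(\<lambda>\<omega>. ruelle_growth (brownian_potential B \<omega>) n) \<in> borel_measurable M"
  unfolding ruelle_growth_eq_SUP
  by (intro borel_measurable_cSUP measurable_ruelle_iter_one) (auto intro!: bdd_aboveI2 ruelle_iter_one_le)

lemma lambda_B_eq: "lambda_B B \<omega> = ruelle_radius (brownian_potential B \<omega>)"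
  by (simp add: lambda_B_def op_spectral_radius_ruelle)

lemma (in brownian_motion_01) measurable_lambda_B: "lambda_B B \<in> borel_measurable M"
  unfolding lambda_B_eq[abs_def] ruelle_radius_def
  by (intro borel_measurable_cINF bdd_below_root_ruelle_growth)
    (use measurable_ruelle_growth in \<open>auto intro!: borel_measurable_root\<close>)

section \<open>The expected spectral radius\<close>

text \<open>The radius is at most the norm of \<open>L 1\<close>; the factor 2 counts the preimages
  of a point.\<close>

lemma ruelle_radius_le:
  fixes f :: "bool stream \<Rightarrow>\<^sub>C real"
  assumes "\<And>x. exp (f x) \<le> m"
  shows "ruelle_radius f \<le> 2 * m"
proof (rule order_trans[OF ruelle_radius_le_growth_1])
  show "ruelle_growth f 1 \<le> 2 * m"
    unfolding ruelle_growth_def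
  proof (rule norm_bound)
    show "norm (ruelle_iter f 1 (const_bcontfun 1) x) \<le> 2 * m" for x
      using assms[of "False ## x"] assms[of "True ## x"] by (simp add: ruelle_eq const_bcontfun.rep_eq)
  qed
qed

text \<open>At the fixed point of the shift the Brownian potential is therefore
  \<open>B 1\<close>.\<close>

lemma dyadic_sconst_True: "dyadic (sconst True) = 1"
  using power_half_series by (simp add: dyadic_def sums_iff)

theorem theorem2:
  fixes M :: "'w measure" and B :: "real \<Rightarrow> 'w \<Rightarrow> real"
  assumes "brownian_motion_01 M B"
  shows "integrable M (lambda_B B) \<and>
    exp (1/2) \<le> prob_space.expectation M (lambda_B B) \<and>
    prob_space.expectation M (lambda_B B) \<le> 4 * exp (1/2)"
proof -
  interpret brownian_motion_01 M B by fact
  obtain Y :: "'w \<Rightarrow> ennreal" where Y: "Y \<in> borel_measurable M"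
    "(\<integral>\<^sup>+\<omega>. Y \<omega> \<partial>M) \<le> 2 * ennreal (exp (1/2))"
    "AE \<omega> in M. \<forall>s\<in>{0..1}. ennreal (exp (B s \<omega>)) \<le> Y \<omega>"
    by (rule obtain_path_bound)
  have nonneg: "0 \<le> lambda_B B \<omega>" for \<omega>
    using ruelle_radius_pos by (simp add: lambda_B_eq less_imp_le)
  have "AE \<omega> in M. ennreal (lambda_B B \<omega>) \<le> 2 * Y \<omega>"
    using Y(3) continuous_paths
  proof eventually_elim
    fix \<omega> assume le: "\<forall>s\<in>{0..1}. ennreal (exp (B s \<omega>)) \<le> Y \<omega>"
      and cont: "continuous_on {0..1} (\<lambda>s. B s \<omega>)"
    show "ennreal (lambda_B B \<omega>) \<le> 2 * Y \<omega>"
    \<comment> \<open>A finite value serves as the real bound \<open>m\<close>; at infinity the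
      claim is trivial.\<close>
    proof (cases "Y \<omega>")
      case (real m)
      have "exp (brownian_potential B \<omega> x) \<le> m" for x
        using le dyadic_in_01[of x] real by (simp add: brownian_potential_apply[where B = B and \<omega> = \<omega>, OF cont])
      then have "lambda_B B \<omega> \<le> 2 * m" unfolding lambda_B_eq by (rule ruelle_radius_le)
      then have "ennreal (lambda_B B \<omega>) \<le> ennreal (2 * m)" by (rule ennreal_leI)
      then show ?thesis using real by (simp add: ennreal_mult)
    qed (simp add: ennreal_mult_top)
  qed
  then have "(\<integral>\<^sup>+\<omega>. ennreal (lambda_B B \<omega>) \<partial>M) \<le> (\<integral>\<^sup>+\<omega>. 2 * Y \<omega> \<partial>M)"
    by (rule nn_integral_mono_AE)
  also have "\<dots> = 2 * (\<integral>\<^sup>+\<omega>. Y \<omega> \<partial>M)" by (rule nn_integral_cmult[OF Y(1)])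
  \<comment> \<open>The final 4 combines the two preimages with the 2 of Levy's inequality.\<close>
  also have "\<dots> \<le> 2 * (2 * ennreal (exp (1/2)))" by (rule mult_left_mono[OF Y(2)]) simp
  also have "\<dots> = ennreal (4 * exp (1/2))"
    by (simp add: ennreal_mult mult.assoc[symmetric])
  finally have upper: "(\<integral>\<^sup>+\<omega>. ennreal (lambda_B B \<omega>) \<partial>M) \<le> ennreal (4 * exp (1/2))" .
  \<comment> \<open>The increment equals \<open>B 1\<close> almost surely and is standard normal by
    \<open>normal_increments\<close>.\<close>
  have "AE \<omega> in M. ennreal (exp (B 1 \<omega> - B 0 \<omega>)) \<le> ennreal (lambda_B B \<omega>)"
    using start_0 continuous_paths
  proof eventually_elim
    fix \<omega> assume B0: "B 0 \<omega> = 0" and cont: "continuous_on {0..1} (\<lambda>s. B s \<omega>)"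
    show "ennreal (exp (B 1 \<omega> - B 0 \<omega>)) \<le> ennreal (lambda_B B \<omega>)"
      using exp_le_ruelle_radius[of "brownian_potential B \<omega>"]
      by (intro ennreal_leI)
        (simp add: B0 lambda_B_eq brownian_potential_apply[where B = B and \<omega> = \<omega>, OF cont] dyadic_sconst_True del: id_apply)
  qed
  then have "(\<integral>\<^sup>+\<omega>. ennreal (exp (B 1 \<omega> - B 0 \<omega>)) \<partial>M) \<le> (\<integral>\<^sup>+\<omega>. ennreal (lambda_B B \<omega>) \<partial>M)"
    by (rule nn_integral_mono_AE)
  moreover have "(\<integral>\<^sup>+\<omega>. ennreal (exp (B 1 \<omega> - B 0 \<omega>)) \<partial>M) = ennreal (exp (1/2))"
    by (rule nn_integral_exp_std_normal) (use normal_increments[of 0 1] in simp)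
  ultimately have lower: "ennreal (exp (1/2)) \<le> (\<integral>\<^sup>+\<omega>. ennreal (lambda_B B \<omega>) \<partial>M)" by simp
  have int: "integrable M (lambda_B B)"
    using measurable_lambda_B nonneg upper
    by (intro integrableI_nonneg) (auto simp: less_top[symmetric] top_unique)
  have eq: "(\<integral>\<^sup>+\<omega>. ennreal (lambda_B B \<omega>) \<partial>M) = ennreal (expectation (lambda_B B))"
    using nonneg by (intro nn_integral_eq_integral[OF int]) auto
  have "0 \<le> expectation (lambda_B B)" using nonneg by simp
  with lower upper int show ?thesis unfolding eq by (simp add: ennreal_le_iff)
qed

end
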